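(* Let $\mathcal G$ be a global assertion. If there is a global assertion $\mathcal G'$ such that $\Phi_1(\mathcal G)=\mathcal G'$ or $\Phi_2(\mathcal G)=\mathcal G'$ (i.e. the strengthening algorithm $\Phi_1$ or the propagation algorithm $\Phi_2$ terminates on $\mathcal G$ with the global assertion $\mathcal G'$ and not with a failure outcome $\mathsf{fail}(\mathcal G'',n)$), then $\overline{\mathtt{HS}}(\mathcal G')=\varnothing$, i.e. $\mathcal G'$ has no node violating history sensitivity.
   Context: **Global assertions.** Participants $\mathtt p,\mathtt q,\mathtt s,\mathtt r,\dots$ and variables $u,v,x,\dots$ are drawn from two disjoint countably infinite sets $\mathcal P$ and $\mathcal V$; lists $\vec v$ are identified with their sets of elements when convenient. Expressions $e$ are built from variables, basic data values and the usual arithmetic operations/relations; $\mathit{var}(e)$ is the set of variables of $e$. $\Psi$ is a fixed decidable fragment of first-order logic over such expressions, with quantifiers on variables; $\mathit{var}(\psi)$ is the set of free variables of $\psi\in\Psi$. $\supset$ is logical implication; a condition "$\phi\supset\psi$" means that the implication is valid (for all values of its free variables). $\bot$ means undefined. An interaction is $\iota=\mathtt s\to\mathtt r:\{\vec v\mid\psi\}$ with $\mathtt s,\mathtt r\in\mathcal P$, $\vec v$ a list of pairwise distinct variables (introduced by $\mathtt s$), $\psi\in\Psi$; put $\mathit{snd}(\iota)=\mathtt s$, $\mathit{rcv}(\iota)=\mathtt r$, $\mathit{var}(\iota)=\vec v$, $\mathit{cst}(\iota)=\psi$. Global assertions are generated by $$\mathcal G::=\iota.\mathcal G\ \mid\ \mathtt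 s\to\mathtt r:(\{\psi_j\}l_j:\mathcal G_j)_{j\in J}\ \mid\ \mu\,\mathbf t\langle\vec e\rangle\{\vec v\mid\psi\}.\mathcal G\ \mid\ \mathbf t\langle\vec e\rangle\ \mid\ \mathsf{end}$$ (prefix; branching with labels $l_j$ and guards $\psi_j$; recursive definition with pairwise distinct formal parameters $\vec v$, initial values $\vec e$ of the same length, and invariant $\psi$; recursive call; end). Variables $\mathit{var}(\iota)$ are bound in $\mathit{cst}(\iota)$ and in the continuation; formal parameters are bound in the body of the recursion. Recursive calls are prefix-guarded; bound variables are all distinct and differ from free ones; global assertions are closed (each used variable is introduced by a preceding interaction or is a formal parameter of an enclosing recursive definition). $\mathit{var}(\mathcal G)$ is the set of interaction variables and recursion parameters of $\mathcal G$. **Knowledge.** $\mathtt p$ knows $v\in\mathit{var}(\mathcal G)$ if either some interaction $\iota$ in $\mathcal G$ has $v\in\mathit{var}(\iota)$ and $\mathtt p\in\{\mathit{snd}(\iota),\mathit{rcv}(\iota)\}$, or $v$ is a formal parameter of a recursive definition in $\mathcal G$ such that $\mathtt p$ knows all variables of the corresponding initial expression and, for each recursive call of that recursion in its body, all variables of the corresponding actual argument. $\mathtt{knows}_{\mathtt p}(\mathcal G)$ is the set of variables of $\mathcal G$ known by $\mathtt p$. **Assertion trees.** $\mathtt T(\mathcal G)$ is the syntax tree of $\mathcal G$: for $\iota.\mathcal G'$ the root is labelled $\iota$ with unique child the root of $\mathtt T(\mathcal G')$; for a branching the root is labelled $\mathtt s\to\mathtt r$ with children $n_j$ ($j\in J$)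 labelled $\{\psi_j\}l_j$, each having as unique child the root of $\mathtt T(\mathcal G_j)$; for a recursive definition the root is labelled $\mu\,\mathbf t\langle\vec e\rangle\{\vec v\mid\psi\}$ with unique child the root of $\mathtt T(\mathcal G')$, where $\mathcal G'$ is the body; calls and $\mathsf{end}$ give single nodes with these labels. $\underline n$ is the label of node $n$. $\mathtt A(T)$ is the global assertion with tree $T$ (so $\mathtt A(\mathtt T(\mathcal G))=\mathcal G$), and $\mathtt{knows}_{\mathtt p}(T)=\mathtt{knows}_{\mathtt p}(\mathtt A(T))$. For $n\in T$: $\mathit{var}_T(n)=\mathit{var}(\iota)$ if $\underline n=\iota$, else $\emptyset$; $\mathit{cst}_T(n)=\psi$ if $\underline n=\iota$ with $\mathit{cst}(\iota)=\psi$ or $\underline n=\{\psi\}l$, else $\mathsf{true}$; $\mathit{snd}_T(n),\mathit{rcv}_T(n)$ are the sender and receiver if $\underline n$ is an interaction or $\mathtt s\to\mathtt r$ (undefined otherwise); $\mathit{parent}_T(n)$ is the parent ($\epsilon$ for the root); $n\uparrow_T$ is the path from the root to $n$ (regarded as a tree); $\mathtt{PRED}_T(n)$ is the conjunction of $\mathit{cst}_T(m)$ over all proper ancestors $m$ of $n$ ($\mathsf{true}$ for the root). **History sensitivity.** $\mathtt{resp}_T(n)$ is $\mathit{snd}_T(n)$ if $\underline n$ is an interaction, $\mathit{snd}_T(\mathit{parent}_T(n))$ if $\underline n=\{\psi\}l$, and undefined otherwise. With $T=\mathtt T(\mathcal G)$, $$\overline{\mathtt{HS}}(\mathcal G)=\{n\in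 T\mid \mathit{var}(\mathit{cst}_T(n))\not\subseteq\mathtt{knows}_{\mathtt s}(n\uparrow_T),\ \mathtt s=\mathtt{resp}_T(n)\},$$ and $\mathtt{varHS}_T(n)=\mathit{var}(\mathit{cst}_T(n))\setminus\mathtt{knows}_{\mathtt s}(n\uparrow_T)$ with $\mathtt s=\mathtt{resp}_T(n)$. **Algorithm $\Phi_1$ (strengthening).** Let $T=\mathtt T(\mathcal G)$. $\mathtt{strengthen}(\mathcal G)$ returns: $\mathcal G$ if $\overline{\mathtt{HS}}(\mathcal G)=\varnothing$; if there are $n\in\overline{\mathtt{HS}}(\mathcal G)$, $v\in\mathtt{varHS}_T(n)$ and $v'\in\mathtt{knows}_{\mathtt s}(n\uparrow_T)$, $\mathtt s=\mathtt{resp}_T(n)$, with $\mathtt{PRED}_T(n)\land\psi[v'/v]\supset\psi$ where $\psi=\mathit{cst}_T(n)$, it returns $\mathtt A(T')$ where $T'$ is $T$ with $\psi$ replaced by $\psi[v'/v]$ in the label of $n$ (for some such choice); otherwise the failure outcome $\mathsf{fail}(\mathcal G,n)$ with $n\in\overline{\mathtt{HS}}(\mathcal G)$. $\Phi_1(\mathcal G)=\mathtt{strengthen}(\mathcal G)$ if $\mathtt{strengthen}(\mathcal G)\in\{\mathcal G,\mathsf{fail}(\mathcal G,n)\}$, and $\Phi_1(\mathcal G)=\Phi_1(\mathtt{strengthen}(\mathcal G))$ otherwise. **Algorithm $\Phi_2$ (propagation).** For interaction nodes $n,n'\in T$, $n\prec_T n'$ iff $n$ appears in $n'\uparrow_T$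 and $\mathit{rcv}_T(n)=\mathit{snd}_T(n')$. A vector $n_1,\dots,n_t$ is a chain in $T$ iff $n_i\prec_T n_{i+1}$ for all $i<t$. For a chain $\vec n=n_1\cdots n_t$, $\mathtt P_T(v,\vec n)$ is the tree $T'$ obtained from $T$ by: adding a fresh variable $v_1$ to $\mathit{var}_T(n_1)$ and setting $\mathit{cst}_{T'}(n_1)=\mathit{cst}_T(n_1)\land(v_1=v)$; for $i=2,\dots,t-1$ adding a fresh $v_i$ to $\mathit{var}_T(n_i)$ and setting $\mathit{cst}_{T'}(n_i)=\mathit{cst}_T(n_i)\land(v_i=v_{i-1})$; setting $\mathit{cst}_{T'}(n_t)=\mathit{cst}_T(n_t)[v_{t-1}/v]$; other nodes unchanged. $\mathtt{propagate}(\mathcal G)$ returns, with $T=\mathtt T(\mathcal G)$: $\mathcal G$ if $\overline{\mathtt{HS}}(\mathcal G)=\varnothing$; $\mathtt A(\mathtt P_T(v,\vec n))$ if there are $n\in\overline{\mathtt{HS}}(\mathcal G)$, $v\in\mathtt{varHS}_T(n)$ and a chain $\vec n=n_0\,\vec n_1\,n$ in $T$ (ending in $n$) such that $\mathit{snd}_T(n_0)$ knows $v$ (for some such choice); the failure outcome $\mathsf{fail}(\mathcal G,n)$ with $n\in\overline{\mathtt{HS}}(\mathcal G)$ otherwise. $\Phi_2(\mathcal G)=\mathtt{propagate}(\mathcal G)$ if this is in $\{\mathcal G,\mathsf{fail}(\mathcal G,n)\}$, and $\Phi_2(\mathcal G)=\Phi_2(\mathtt{propagate}(\mathcal G))$ otherwise.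 *)

theory Defs
  imports Main "HOL-Library.Sublist"
begin

section \<open>Expressions and constraints\<close>

datatype participant = Participant nat
datatype variable = Variable nat

type_synonym rec_var = string
type_synonym branch_label = string

text \<open>
  Data values have type \<open>'d\<close>; the symbols \<open>'o\<close> name both the operations and the (boolean-valued)
  relations. Their meaning is given by an interpretation, in which \<open>tt_val\<close> is the data value
  representing truth. The interpretation is arbitrary; the usual arithmetic one is
  an instance.
\<close>

datatype ('d, 'o) expr = Var variable | Val 'd | Op 'o "('d, 'o) expr list"

datatype ('d, 'o) form =
    TT
  | Atom "('d, 'o) expr"
  | Eq "('d, 'o) expr" "('d, 'o) expr"
  | Neg "('d, 'o) form"
  | Conj "('d, 'o) form" "('d, 'o) form"
  | Disj "('d, 'o) form" "('d, 'o) form"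
  | Imp "('d, 'o) form" "('d, 'o) form"
  | Forall variable "('d, 'o) form"
  | Exists variable "('d, 'o) form"

datatype ('d, 'o) interp = Interp (oper: "'o \<Rightarrow> 'd list \<Rightarrow> 'd") (tt_val: 'd)

fun eval :: "('d, 'o) interp \<Rightarrow> (variable \<Rightarrow> 'd) \<Rightarrow> ('d, 'o) expr \<Rightarrow> 'd" where
  "eval I \<rho> (Var v) = \<rho> v"
| "eval I \<rho> (Val d) = d"
| "eval I \<rho> (Op f es) = oper I f (map (eval I \<rho>) es)"

primrec sat :: "('d, 'o) interp \<Rightarrow> (variable \<Rightarrow> 'd) \<Rightarrow> ('d, 'o) form \<Rightarrow> bool" where
  "sat I \<rho> TT \<longleftrightarrow> True"
| "sat I \<rho> (Atom e) \<longleftrightarrow> eval I \<rho> e = tt_val I"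
| "sat I \<rho> (Eq e e') \<longleftrightarrow> eval I \<rho> e = eval I \<rho> e'"
| "sat I \<rho> (Neg \<phi>) \<longleftrightarrow> \<not> sat I \<rho> \<phi>"
| "sat I \<rho> (Conj \<phi> \<psi>) \<longleftrightarrow> sat I \<rho> \<phi> \<and> sat I \<rho> \<psi>"
| "sat I \<rho> (Disj \<phi> \<psi>) \<longleftrightarrow> sat I \<rho> \<phi> \<or> sat I \<rho> \<psi>"
| "sat I \<rho> (Imp \<phi> \<psi>) \<longleftrightarrow> (sat I \<rho> \<phi> \<longrightarrow> sat I \<rho> \<psi>)"
| "sat I \<rho> (Forall x \<phi>) \<longleftrightarrow> (\<forall>d. sat I (\<rho>(x := d)) \<phi>)"
| "sat I \<rho> (Exists x \<phi>) \<longleftrightarrow> (\<exists>d. sat I (\<rho>(x := d)) \<phi>)"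

definition valid :: "('d, 'o) interp \<Rightarrow> ('d, 'o) form \<Rightarrow> bool" where
  "valid I \<phi> \<longleftrightarrow> (\<forall>\<rho>. sat I \<rho> \<phi>)"

fun expr_vars :: "('d, 'o) expr \<Rightarrow> variable set" where
  "expr_vars (Var v) = {v}"
| "expr_vars (Val d) = {}"
| "expr_vars (Op f es) = (\<Union>e\<in>set es. expr_vars e)"

primrec form_vars :: "('d, 'o) form \<Rightarrow> variable set" where
  "form_vars TT = {}"
| "form_vars (Atom e) = expr_vars e"
| "form_vars (Eq e e') = expr_vars e \<union> expr_vars e'"
| "form_vars (Neg \<phi>) = form_vars \<phi>"
| "form_vars (Conj \<phi> \<psi>) = form_vars \<phi> \<union> form_vars \<psi>"
| "form_vars (Disj \<phi> \<psi>) = form_vars \<phi> \<union> form_vars \<psi>"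
| "form_vars (Imp \<phi> \<psi>) = form_vars \<phi> \<union> form_vars \<psi>"
| "form_vars (Forall x \<phi>) = form_vars \<phi> - {x}"
| "form_vars (Exists x \<phi>) = form_vars \<phi> - {x}"

text \<open>The variables at the quantifiers of a formula, with repetitions.\<close>

primrec quantified :: "('d, 'o) form \<Rightarrow> variable list" where
  "quantified TT = []"
| "quantified (Atom e) = []"
| "quantified (Eq e e') = []"
| "quantified (Neg \<phi>) = quantified \<phi>"
| "quantified (Conj \<phi> \<psi>) = quantified \<phi> @ quantified \<psi>"
| "quantified (Disj \<phi> \<psi>) = quantified \<phi> @ quantified \<psi>"
| "quantified (Imp \<phi> \<psi>) = quantified \<phi> @ quantified \<psi>"
| "quantified (Forall x \<phi>) = x # quantified \<phi>"
| "quantified (Exists x \<phi>) = x # quantified \<phi>"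

fun rename_expr :: "(variable \<Rightarrow> variable) \<Rightarrow> ('d, 'o) expr \<Rightarrow> ('d, 'o) expr" where
  "rename_expr \<sigma> (Var v) = Var (\<sigma> v)"
| "rename_expr \<sigma> (Val d) = Val d"
| "rename_expr \<sigma> (Op f es) = Op f (map (rename_expr \<sigma>) es)"

text \<open>A quantified variable is renamed only if it would capture a variable otherwise.\<close>

definition avoid :: "variable \<Rightarrow> variable set \<Rightarrow> variable" where
  "avoid x X = (if x \<notin> X then x else (SOME z. z \<notin> X))"

primrec rename :: "(variable \<Rightarrow> variable) \<Rightarrow> ('d, 'o) form \<Rightarrow> ('d, 'o) form" where
  "rename \<sigma> TT = TT"
| "rename \<sigma> (Atom e) = Atom (rename_expr \<sigma> e)"
| "rename \<sigma> (Eq e e') = Eq (rename_expr \<sigma> e) (rename_expr \<sigma> e')"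
| "rename \<sigma> (Neg \<phi>) = Neg (rename \<sigma> \<phi>)"
| "rename \<sigma> (Conj \<phi> \<psi>) = Conj (rename \<sigma> \<phi>) (rename \<sigma> \<psi>)"
| "rename \<sigma> (Disj \<phi> \<psi>) = Disj (rename \<sigma> \<phi>) (rename \<sigma> \<psi>)"
| "rename \<sigma> (Imp \<phi> \<psi>) = Imp (rename \<sigma> \<phi>) (rename \<sigma> \<psi>)"
| "rename \<sigma> (Forall x \<phi>) =
     (let z = avoid x (\<sigma> ` (form_vars \<phi> - {x})) in Forall z (rename (\<sigma>(x := z)) \<phi>))"
| "rename \<sigma> (Exists x \<phi>) =
     (let z = avoid x (\<sigma> ` (form_vars \<phi> - {x})) in Exists z (rename (\<sigma>(x := z)) \<phi>))"

text \<open>\<open>subst \<psi> u v\<close> is the capture-avoiding \<open>\<psi>[u/v]\<close>: \<open>u\<close> replaces \<open>v\<close>.\<close>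

definition subst :: "('d, 'o) form \<Rightarrow> variable \<Rightarrow> variable \<Rightarrow> ('d, 'o) form" where
  "subst \<psi> u v = rename (id(v := u)) \<psi>"


section \<open>Global assertions and assertion trees\<close>

datatype ('d, 'o) interaction =
  Interaction (sender: participant) (receiver: participant)
    (ivars: "variable list") (icst: "('d, 'o) form")

text \<open>Raw syntax; the side conditions are imposed by \<open>global_assertion\<close> below.\<close>

datatype ('d, 'o) gassert =
    Prefix "('d, 'o) interaction" "('d, 'o) gassert"
  | Branch participant participant "(('d, 'o) form \<times> branch_label \<times> ('d, 'o) gassert) list"
  | Rec rec_var "('d, 'o) expr list" "variable list" "('d, 'o) form" "('d, 'o) gassert"
  | Call rec_var "('d, 'o) expr list"
  | End

datatype ('d, 'o) label =
    LInter "('d, 'o) interaction"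
  | LSelect participant participant
  | LGuard "('d, 'o) form" branch_label
  | LRec rec_var "('d, 'o) expr list" "variable list" "('d, 'o) form"
  | LCall rec_var "('d, 'o) expr list"
  | LEnd

datatype ('d, 'o) tree = Node (root_label: "('d, 'o) label") (children: "('d, 'o) tree list")

fun syntax_tree :: "('d, 'o) gassert \<Rightarrow> ('d, 'o) tree" where
  "syntax_tree (Prefix \<iota> G) = Node (LInter \<iota>) [syntax_tree G]"
| "syntax_tree (Branch s r bs) =
     Node (LSelect s r) (map (\<lambda>(\<psi>, l, G). Node (LGuard \<psi> l) [syntax_tree G]) bs)"
| "syntax_tree (Rec t es vs \<psi> G) = Node (LRec t es vs \<psi>) [syntax_tree G]"
| "syntax_tree (Call t es) = Node (LCall t es) []"
| "syntax_tree End = Node LEnd []"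

text \<open>A node is the list of child indices leading to it from the root.\<close>

type_synonym node = "nat list"

fun subtree_at :: "('d, 'o) tree \<Rightarrow> node \<Rightarrow> ('d, 'o) tree option" where
  "subtree_at t [] = Some t"
| "subtree_at (Node a ts) (i # n) = (if i < length ts then subtree_at (ts ! i) n else None)"

definition nodes :: "('d, 'o) tree \<Rightarrow> node set" where
  "nodes T = {n. subtree_at T n \<noteq> None}"

definition label_at :: "('d, 'o) tree \<Rightarrow> node \<Rightarrow> ('d, 'o) label" where
  "label_at T n = root_label (the (subtree_at T n))"

fun relabel :: "node \<Rightarrow> (('d, 'o) label \<Rightarrow> ('d, 'o) label) \<Rightarrow> ('d, 'o) tree \<Rightarrow> ('d, 'o) tree" where
  "relabel [] f (Node a ts) = Node (f a) ts"
| "relabel (i # n) f (Node a ts) = Node a (ts[i := relabel n f (ts ! i)])"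

text \<open>The path from the root to \<open>n\<close>, including \<open>n\<close>, as a tree.\<close>

fun path_to :: "('d, 'o) tree \<Rightarrow> node \<Rightarrow> ('d, 'o) tree" where
  "path_to (Node a ts) [] = Node a []"
| "path_to (Node a ts) (i # n) = Node a [path_to (ts ! i) n]"

fun label_cst :: "('d, 'o) label \<Rightarrow> ('d, 'o) form" where
  "label_cst (LInter \<iota>) = icst \<iota>"
| "label_cst (LGuard \<psi> l) = \<psi>"
| "label_cst _ = TT"

fun map_label_cst :: "(('d, 'o) form \<Rightarrow> ('d, 'o) form) \<Rightarrow> ('d, 'o) label \<Rightarrow> ('d, 'o) label" where
  "map_label_cst f (LInter (Interaction s r vs \<psi>)) = LInter (Interaction s r vs (f \<psi>))"
| "map_label_cst f (LGuard \<psi> l) = LGuard (f \<psi>) l"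
| "map_label_cst f a = a"

fun add_label_var :: "variable \<Rightarrow> ('d, 'o) label \<Rightarrow> ('d, 'o) label" where
  "add_label_var w (LInter (Interaction s r vs \<psi>)) = LInter (Interaction s r (vs @ [w]) \<psi>)"
| "add_label_var w a = a"

definition cst :: "('d, 'o) tree \<Rightarrow> node \<Rightarrow> ('d, 'o) form" where
  "cst T n = label_cst (label_at T n)"

definition snd_at :: "('d, 'o) tree \<Rightarrow> node \<Rightarrow> participant option" where
  "snd_at T n = (case label_at T n of
     LInter \<iota> \<Rightarrow> Some (sender \<iota>) | LSelect s r \<Rightarrow> Some s | _ \<Rightarrow> None)"

definition rcv_at :: "('d, 'o) tree \<Rightarrow> node \<Rightarrow> participant option" where
  "rcv_at T n = (case label_at T n of
     LInter \<iota> \<Rightarrow> Some (receiver \<iota>) | LSelect s r \<Rightarrow> Some r | _ \<Rightarrow> None)"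

definition parent :: "node \<Rightarrow> node option" where
  "parent n = (if n = [] then None else Some (butlast n))"

definition PRED :: "('d, 'o) tree \<Rightarrow> node \<Rightarrow> ('d, 'o) form" where
  "PRED T n = foldr (\<lambda>k \<phi>. Conj (cst T (take k n)) \<phi>) [0..<length n] TT"

text \<open>
  \<open>call_of T n m\<close>: the node \<open>m\<close> is a recursive call of the recursion defined at the node \<open>n\<close>.
\<close>

definition call_of :: "('d, 'o) tree \<Rightarrow> node \<Rightarrow> node \<Rightarrow> bool" where
  "call_of T n m \<longleftrightarrow> n \<in> nodes T \<and> m \<in> nodes T \<and> strict_prefix n m \<and>
     (\<exists>t es vs \<psi> as. label_at T n = LRec t es vs \<psi> \<and> label_at T m = LCall t as \<and>
       (\<forall>k es' vs' \<psi>'. strict_prefix n k \<and> strict_prefix k m \<longrightarrow> label_at T k \<noteq> LRec t es' vs' \<psi>'))"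

fun label_args :: "('d, 'o) label \<Rightarrow> ('d, 'o) expr list" where
  "label_args (LRec t es vs \<psi>) = es"
| "label_args (LCall t as) = as"
| "label_args _ = []"

fun label_binds :: "('d, 'o) label \<Rightarrow> variable list" where
  "label_binds (LInter \<iota>) = ivars \<iota>"
| "label_binds (LRec t es vs \<psi>) = vs"
| "label_binds _ = []"

fun label_forms :: "('d, 'o) label \<Rightarrow> ('d, 'o) form list" where
  "label_forms (LInter \<iota>) = [icst \<iota>]"
| "label_forms (LGuard \<psi> l) = [\<psi>]"
| "label_forms (LRec t es vs \<psi>) = [\<psi>]"
| "label_forms _ = []"

definition label_bound_vars :: "('d, 'o) label \<Rightarrow> variable list" where
  "label_bound_vars a = label_binds a @ concat (map quantified (label_forms a))"

definition arg_vars :: "('d, 'o) label \<Rightarrow> variable set" where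
  "arg_vars a = (\<Union>e\<in>set (label_args a). expr_vars e)"

definition cst_vars :: "('d, 'o) label \<Rightarrow> variable set" where
  "cst_vars a = (\<Union>\<psi>\<in>set (label_forms a). form_vars \<psi>)"

definition occurring :: "('d, 'o) tree \<Rightarrow> variable set" where
  "occurring T = (\<Union>n\<in>nodes T. set (label_bound_vars (label_at T n)) \<union>
     arg_vars (label_at T n) \<union> cst_vars (label_at T n))"

text \<open>
  The variables bound at the proper ancestors of a node. The constraint of an interaction and the
  invariant of a recursion may in addition use the variables bound at their own node, whereas
  the initial values of a recursion may not.
\<close>

definition scope :: "('d, 'o) tree \<Rightarrow> node \<Rightarrow> variable set" where
  "scope T n = (\<Union>m\<in>{m. strict_prefix m n}. set (label_binds (label_at T m)))"

definition closed_tree :: "('d, 'o) tree \<Rightarrow> bool" where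
  "closed_tree T \<longleftrightarrow> (\<forall>n\<in>nodes T.
     arg_vars (label_at T n) \<subseteq> scope T n \<and>
     cst_vars (label_at T n) \<subseteq> scope T n \<union> set (label_binds (label_at T n)))"

definition distinct_bound_vars :: "('d, 'o) tree \<Rightarrow> bool" where
  "distinct_bound_vars T \<longleftrightarrow>
     (\<forall>n\<in>nodes T. distinct (label_bound_vars (label_at T n))) \<and>
     (\<forall>n\<in>nodes T. \<forall>m\<in>nodes T. n \<noteq> m \<longrightarrow>
       set (label_bound_vars (label_at T n)) \<inter> set (label_bound_vars (label_at T m)) = {})"

definition well_formed_recursion :: "('d, 'o) tree \<Rightarrow> bool" where
  "well_formed_recursion T \<longleftrightarrow>
     (\<forall>n\<in>nodes T. \<forall>t es vs \<psi>. label_at T n = LRec t es vs \<psi> \<longrightarrow> length es = length vs) \<and>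
     (\<forall>m\<in>nodes T. \<forall>t as. label_at T m = LCall t as \<longrightarrow> (\<exists>n. call_of T n m)) \<and>
     (\<forall>n m. call_of T n m \<longrightarrow>
       length (label_args (label_at T m)) = length (label_binds (label_at T n)) \<and>
       (\<exists>k. strict_prefix n k \<and> strict_prefix k m \<and>
         (\<exists>\<iota> s r. label_at T k = LInter \<iota> \<or> label_at T k = LSelect s r)))"

text \<open>\<open>\<Psi>\<close> is the chosen fragment of the first-order formulas.\<close>

definition global_assertion :: "('d, 'o) form set \<Rightarrow> ('d, 'o) gassert \<Rightarrow> bool" where
  "global_assertion \<Psi> G \<longleftrightarrow> (let T = syntax_tree G in
     (\<forall>n\<in>nodes T. set (label_forms (label_at T n)) \<subseteq> \<Psi>) \<and>
     distinct_bound_vars T \<and> closed_tree T \<and> well_formed_recursion T)"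


section \<open>Knowledge and history sensitivity\<close>

text \<open>
  Knowledge is defined on trees rather than on assertions, because a path to a node is in general
  not the syntax tree of an assertion.
\<close>

inductive_set knows :: "participant \<Rightarrow> ('d, 'o) tree \<Rightarrow> variable set"
  for p :: participant and T :: "('d, 'o) tree" where
  interaction: "v \<in> knows p T"
    if "n \<in> nodes T" and "label_at T n = LInter \<iota>"
      and "v \<in> set (ivars \<iota>)" and "p \<in> {sender \<iota>, receiver \<iota>}"
| parameter: "vs ! i \<in> knows p T"
    if "n \<in> nodes T" and "label_at T n = LRec t es vs \<psi>"
      and "i < length vs"
      and "\<forall>u\<in>expr_vars (es ! i). u \<in> knows p T"
      and "\<forall>m. call_of T n m \<longrightarrow> (\<forall>u\<in>expr_vars (label_args (label_at T m) ! i). u \<in> knows p T)"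

definition resp :: "('d, 'o) tree \<Rightarrow> node \<Rightarrow> participant option" where
  "resp T n = (case label_at T n of
     LInter \<iota> \<Rightarrow> snd_at T n | LGuard \<psi> l \<Rightarrow> Option.bind (parent n) (snd_at T) | _ \<Rightarrow> None)"

definition HS_bar :: "('d, 'o) gassert \<Rightarrow> node set" where
  "HS_bar G = (let T = syntax_tree G in
     {n \<in> nodes T. \<exists>s. resp T n = Some s \<and> \<not> form_vars (cst T n) \<subseteq> knows s (path_to T n)})"

text \<open>Only meaningful at nodes whose responsible participant is defined.\<close>

definition varHS :: "('d, 'o) tree \<Rightarrow> node \<Rightarrow> variable set" where
  "varHS T n = form_vars (cst T n) - knows (the (resp T n)) (path_to T n)"


section \<open>The two algorithms\<close>

text \<open>
  The algorithms leave choices open, so they are rendered as relations between an assertion and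
  a possible outcome.
\<close>

datatype ('d, 'o) outcome = Assertion "('d, 'o) gassert" | Failure "('d, 'o) gassert" node

definition strengthens_to ::
    "('d, 'o) interp \<Rightarrow> ('d, 'o) gassert \<Rightarrow> ('d, 'o) gassert \<Rightarrow> bool" where
  "strengthens_to I G G1 \<longleftrightarrow> (let T = syntax_tree G in
     \<exists>n\<in>HS_bar G. \<exists>v\<in>varHS T n. \<exists>v'\<in>knows (the (resp T n)) (path_to T n).
       valid I (Imp (Conj (PRED T n) (subst (cst T n) v' v)) (cst T n)) \<and>
       syntax_tree G1 = relabel n (map_label_cst (\<lambda>\<psi>. subst \<psi> v' v)) T)"

inductive strengthen ::
    "('d, 'o) interp \<Rightarrow> ('d, 'o) gassert \<Rightarrow> ('d, 'o) outcome \<Rightarrow> bool"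
  for I :: "('d, 'o) interp" where
  "strengthen I G (Assertion G)" if "HS_bar G = {}"
| "strengthen I G (Assertion G1)" if "strengthens_to I G G1"
| "strengthen I G (Failure G n)" if "n \<in> HS_bar G" and "\<nexists>G1. strengthens_to I G G1"

inductive Phi1 :: "('d, 'o) interp \<Rightarrow> ('d, 'o) gassert \<Rightarrow> ('d, 'o) outcome \<Rightarrow> bool"
  for I :: "('d, 'o) interp" where
  "Phi1 I G (Assertion G)" if "strengthen I G (Assertion G)"
| "Phi1 I G (Failure G n)" if "strengthen I G (Failure G n)"
| "Phi1 I G res" if "strengthen I G (Assertion G1)" and "G1 \<noteq> G" and "Phi1 I G1 res"

definition prec :: "('d, 'o) tree \<Rightarrow> node \<Rightarrow> node \<Rightarrow> bool" where
  "prec T n n' \<longleftrightarrow> n \<in> nodes T \<and> n' \<in> nodes T \<and>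
     (\<exists>\<iota> \<iota>'. label_at T n = LInter \<iota> \<and> label_at T n' = LInter \<iota>') \<and>
     prefix n n' \<and> rcv_at T n = snd_at T n'"

definition chain :: "('d, 'o) tree \<Rightarrow> node list \<Rightarrow> bool" where
  "chain T ns \<longleftrightarrow> successively (prec T) ns"

text \<open>
  \<open>propagate_from v u ns ws T\<close> treats the remaining nodes \<open>ns\<close> of a chain, with the fresh variables
  \<open>ws\<close> for all of them but the last; \<open>u\<close> is the variable carrying the value of \<open>v\<close> so far.
\<close>

fun propagate_from ::
    "variable \<Rightarrow> variable \<Rightarrow> node list \<Rightarrow> variable list \<Rightarrow> ('d, 'o) tree \<Rightarrow> ('d, 'o) tree" where
  "propagate_from v u (n # n' # ns) (w # ws) T =
     propagate_from v w (n' # ns) ws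
       (relabel n (add_label_var w \<circ> map_label_cst (\<lambda>\<psi>. Conj \<psi> (Eq (Var w) (Var u)))) T)"
| "propagate_from v u [n] [] T = relabel n (map_label_cst (\<lambda>\<psi>. subst \<psi> u v)) T"
| "propagate_from v u _ _ T = T"

definition P_tree ::
    "variable \<Rightarrow> node list \<Rightarrow> variable list \<Rightarrow> ('d, 'o) tree \<Rightarrow> ('d, 'o) tree" where
  "P_tree v ns ws T = propagate_from v v ns ws T"

definition propagates_to :: "('d, 'o) gassert \<Rightarrow> ('d, 'o) gassert \<Rightarrow> bool" where
  "propagates_to G G1 \<longleftrightarrow> (let T = syntax_tree G in
     \<exists>n\<in>HS_bar G. \<exists>v\<in>varHS T n. \<exists>n0 ns s ws.
       chain T (n0 # ns @ [n]) \<and> snd_at T n0 = Some s \<and> v \<in> knows s T \<and>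
       length ws = Suc (length ns) \<and> distinct ws \<and> set ws \<inter> occurring T = {} \<and>
       syntax_tree G1 = P_tree v (n0 # ns @ [n]) ws T)"

inductive propagate :: "('d, 'o) gassert \<Rightarrow> ('d, 'o) outcome \<Rightarrow> bool" where
  "propagate G (Assertion G)" if "HS_bar G = {}"
| "propagate G (Assertion G1)" if "propagates_to G G1"
| "propagate G (Failure G n)" if "n \<in> HS_bar G" and "\<nexists>G1. propagates_to G G1"

inductive Phi2 :: "('d, 'o) gassert \<Rightarrow> ('d, 'o) outcome \<Rightarrow> bool" where
  "Phi2 G (Assertion G)" if "propagate G (Assertion G)"
| "Phi2 G (Failure G n)" if "propagate G (Failure G n)"
| "Phi2 G res" if "propagate G (Assertion G1)" and "G1 \<noteq> G" and "Phi2 G1 res"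

end

theory Submission
  imports Defs
begin

text \<open>
  Both algorithms stop with an assertion only where a step returns its argument, so it suffices that
  a proper step changes the tree. A strengthening step removes the variable \<open>v\<close> from the free
  variables of the constraint at the chosen node: the variable replacing it is known to the
  responsible participant, while \<open>v\<close> is not. A propagation step adds a fresh variable to the
  first node of the chain, and no later update removes an introduced variable.
\<close>

text \<open>Comparing options rather than labels lets one induction yield both that
  \<open>relabel\<close> preserves the set of nodes and how it changes each label.\<close>

lemma map_root_label_subtree_at_relabel:
  "map_option root_label (subtree_at (relabel n f T) m) =
     map_option (\<lambda>t. (if m = n then f else id) (root_label t)) (subtree_at T m)"
proof (induction n f T arbitrary: m rule: relabel.induct)
  case (1 f a ts)
  then show ?case by (cases m) auto
next
  case (2 i n f a ts)
  show ?case
  proof (cases m)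
    case Nil
    then show ?thesis by simp
  next
    case (Cons j k)
    then show ?thesis using "2.IH" by (cases "j = i") auto
  qed
qed

lemma nodes_relabel [simp]: "nodes (relabel n f T) = nodes T"
proof -
  have "subtree_at (relabel n f T) m = None \<longleftrightarrow> subtree_at T m = None" for m
    using map_root_label_subtree_at_relabel[of n f T m] by (metis option.map_disc_iff)
  then show ?thesis by (simp add: nodes_def)
qed

lemma label_at_relabel:
  assumes "m \<in> nodes T"
  shows "label_at (relabel n f T) m = (if m = n then f (label_at T m) else label_at T m)"
proof -
  obtain t where t: "subtree_at T m = Some t"
    using assms by (auto simp: nodes_def)
  then obtain t' where "subtree_at (relabel n f T) m = Some t'"
    using assms nodes_relabel[of n f T] by (fastforce simp: nodes_def)
  with t show ?thesis
    using map_root_label_subtree_at_relabel[of n f T m] by (auto simp: label_at_def)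
qed

lemma finite_expr_vars: "finite (expr_vars e)"
  by (induction e rule: expr_vars.induct) auto

lemma finite_form_vars: "finite (form_vars \<phi>)"
  by (induction \<phi>) (auto simp: finite_expr_vars)

lemma infinite_UNIV_variable: "infinite (UNIV :: variable set)"
proof -
  have "inj Variable" by (simp add: inj_def)
  then show ?thesis by (metis finite_subset finite_imageD infinite_UNIV_nat subset_UNIV)
qed

lemma avoid_notin: "finite X \<Longrightarrow> avoid x X \<notin> X"
  unfolding avoid_def by (metis ex_new_if_finite infinite_UNIV_variable someI_ex)

lemma expr_vars_rename_expr: "expr_vars (rename_expr \<sigma> e) = \<sigma> ` expr_vars e"
  by (induction e rule: expr_vars.induct) auto

text \<open>This is the quantifier case of \<open>form_vars_rename\<close>. The chosen
  \<open>z\<close> avoids the images of the other free variables, so deleting it removes only the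
  contribution of \<open>x\<close>. Finiteness of \<open>X\<close> guarantees that a variable to
  choose exists.\<close>

lemma image_fun_upd_avoid:
  fixes \<sigma> :: "variable \<Rightarrow> variable" and x :: variable
  assumes "finite X"
  defines "z \<equiv> avoid x (\<sigma> ` (X - {x}))"
  shows "(\<sigma>(x := z)) ` X - {z} = \<sigma> ` (X - {x})"
proof -
  have "z \<notin> \<sigma> ` (X - {x})"
    unfolding z_def using assms(1) by (intro avoid_notin) simp
  then show ?thesis by (auto split: if_splits)
qed

lemma form_vars_rename: "form_vars (rename \<sigma> \<phi>) = \<sigma> ` form_vars \<phi>"
  by (induction \<phi> arbitrary: \<sigma>)
    (simp_all add: expr_vars_rename_expr image_Un Let_def image_fun_upd_avoid finite_form_vars
      del: fun_upd_apply)

text \<open>The free variables of the result are an image under \<open>id(v := u)\<close>, a map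
  that never takes the value \<open>v\<close> when \<open>u\<close> differs from
  \<open>v\<close>.\<close>

lemma notin_form_vars_subst: "u \<noteq> v \<Longrightarrow> v \<notin> form_vars (subst \<psi> u v)"
  by (auto simp: subst_def form_vars_rename)

text \<open>\<open>resp\<close> is defined only at interactions and guards, the labels whose
  constraint \<open>map_label_cst\<close> rewrites; at all others \<open>label_cst\<close> stays
  \<open>TT\<close>.\<close>

lemma label_cst_map_label_cst:
  "resp T n \<noteq> None \<Longrightarrow>
     label_cst (map_label_cst f (label_at T n)) = f (label_cst (label_at T n))"
  by (cases "(f, label_at T n)" rule: map_label_cst.cases) (auto simp: resp_def)

lemma strengthens_to_irrefl: "\<not> strengthens_to I G G"
proof
  define T where "T = syntax_tree G"
  assume "strengthens_to I G G"
  then obtain n v v' where n: "n \<in> HS_bar G" and v: "v \<in> varHS T n"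
    and v': "v' \<in> knows (the (resp T n)) (path_to T n)"
    and T: "T = relabel n (map_label_cst (\<lambda>\<psi>. subst \<psi> v' v)) T"
    unfolding strengthens_to_def T_def[symmetric] Let_def by blast
  have "n \<in> nodes T" "resp T n \<noteq> None"
    using n by (auto simp: HS_bar_def T_def Let_def)
  \<comment> \<open>Both sides of the fixed-point equation for \<open>T\<close> are read off at the
    node \<open>n\<close>.\<close>
  then have "cst T n = subst (cst T n) v' v"
    using T label_at_relabel label_cst_map_label_cst unfolding cst_def by metis
  moreover have "v \<in> form_vars (cst T n)" "v' \<noteq> v"
    using v v' by (auto simp: varHS_def)
  ultimately show False using notin_form_vars_subst by metis
qed

lemma label_binds_map_label_cst: "label_binds (map_label_cst f a) = label_binds a"
  by (cases "(f, a)" rule: map_label_cst.cases) auto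

lemma label_binds_add_label_var: "set (label_binds a) \<subseteq> set (label_binds (add_label_var w a))"
  by (cases "(w, a)" rule: add_label_var.cases) auto

text \<open>The node list is arbitrary because a chain may repeat a node: \<open>prec\<close> uses
  the reflexive \<open>prefix\<close>, so a later update can hit a node already extended.\<close>

lemma label_binds_propagate_from:
  "m \<in> nodes T \<Longrightarrow>
     set (label_binds (label_at T m)) \<subseteq> set (label_binds (label_at (propagate_from v u ns ws T) m))"
proof (induction v u ns ws T rule: propagate_from.induct)
  case (1 v u n n' ns w ws T)
  let ?f = "add_label_var w \<circ> map_label_cst (\<lambda>\<psi>. Conj \<psi> (Eq (Var w) (Var u)))"
  have "set (label_binds (label_at T m)) \<subseteq> set (label_binds (label_at (relabel n ?f T) m))"
    using "1.prems"
      label_binds_add_label_var[of "map_label_cst (\<lambda>\<psi>. Conj \<psi> (Eq (Var w) (Var u))) (label_at T m)" w]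
    by (cases "m = n") (simp_all add: label_at_relabel label_binds_map_label_cst)
  then show ?case using 1 by (simp add: subset_trans)
qed (auto simp: label_at_relabel label_binds_map_label_cst)

lemma propagates_to_irrefl: "\<not> propagates_to G G"
proof
  define T where "T = syntax_tree G"
  assume "propagates_to G G"
  then obtain n v n0 ns ws where chain: "chain T (n0 # ns @ [n])"
    and ws: "length ws = Suc (length ns)" "set ws \<inter> occurring T = {}"
    and T: "T = P_tree v (n0 # ns @ [n]) ws T"
    unfolding propagates_to_def T_def[symmetric] Let_def by blast
  \<comment> \<open>The chain has at least two nodes, so \<open>n0\<close> is not its last one and
    the first equation of \<open>propagate_from\<close> adds the first fresh variable
    \<open>w\<close> there.\<close>
  obtain n' ns' where ns: "ns @ [n] = n' # ns'" by (cases ns) auto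
  obtain w ws' where w: "ws = w # ws'" using ws by (cases ws) auto
  let ?T = "relabel n0 (add_label_var w \<circ> map_label_cst (\<lambda>\<psi>. Conj \<psi> (Eq (Var w) (Var v)))) T"
  \<comment> \<open>\<open>n0\<close> must be an interaction node, since
    \<open>add_label_var\<close> leaves all other labels unchanged.\<close>
  have "prec T n0 n'" using chain by (simp add: chain_def ns)
  then obtain \<iota> where n0: "n0 \<in> nodes T" and \<iota>: "label_at T n0 = LInter \<iota>"
    by (auto simp: prec_def)
  have "w \<in> set (label_binds (label_at ?T n0))"
    using n0 \<iota> by (cases \<iota>) (simp add: label_at_relabel)
  also have "\<dots> \<subseteq> set (label_binds (label_at (propagate_from v w (n' # ns') ws' ?T) n0))"
    using n0 by (intro label_binds_propagate_from) simp
  also have "propagate_from v w (n' # ns') ws' ?T = T"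
    using T by (simp add: P_tree_def ns w)
  finally have "w \<in> occurring T"
    using n0 by (auto simp: occurring_def label_bound_vars_def)
  then show False using ws(2) by (simp add: w)
qed

text \<open>A final call relates an assertion to itself, either because \<open>HS_bar\<close> is
  empty or by a proper step; irreflexivity excludes the latter. Recursive calls pass the result on
  unchanged.\<close>

lemma HS_bar_Phi1: "Phi1 I G (Assertion G') \<Longrightarrow> HS_bar G' = {}"
  by (induction G "Assertion G'" rule: Phi1.induct)
    (auto elim: strengthen.cases simp: strengthens_to_irrefl)

lemma HS_bar_Phi2: "Phi2 G (Assertion G') \<Longrightarrow> HS_bar G' = {}"
  by (induction G "Assertion G'" rule: Phi2.induct)
    (auto elim: propagate.cases simp: propagates_to_irrefl)

theorem theorem23:
  fixes \<Psi> :: "('d, 'o) form set" and I :: "('d, 'o) interp"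
    and G G' :: "('d, 'o) gassert"
  assumes "global_assertion \<Psi> G" and "global_assertion \<Psi> G'"
    and "Phi1 I G (Assertion G') \<or> Phi2 G (Assertion G')"
  shows "HS_bar G' = {}"
  using assms(3) HS_bar_Phi1 HS_bar_Phi2 by blast

end
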